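(* The best (i.e. smallest) constant $c$ such that the inequality $$\|f\ast f\|_{2}^2\le c\,\|f\ast f\|_{1}\,\|f\ast f\|_{\infty}$$ holds for every real-valued $f\in L^1(\mathbb{R})\cap L^2(\mathbb{R})$ is $c=1$.
   Context: Here $(f\ast f)(t)=\int_{\mathbb{R}} f(t-x)f(x)\,dx$ is the autoconvolution and $\|\cdot\|_p$ is the $L^p(\mathbb{R})$ norm with respect to Lebesgue measure. The functions $f$ are not assumed to be nonnegative. *)

theory Defs
  imports "HOL-Probability.Essential_Supremum"
begin

text \<open>
  The norm takes values in \<^typ>\<open>ereal\<close>, so that it is defined, and possibly infinite, for every
  measurable function; no infinite value is collapsed to a default real number. It is
  meant for \<open>1 \<le> p \<le> \<infinity>\<close>.
\<close>

definition Lp_norm :: "ereal \<Rightarrow> (real \<Rightarrow> real) \<Rightarrow> ereal" where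
  "Lp_norm p f =
    (if p = \<infinity> then esssup lebesgue (\<lambda>x. ereal \<bar>f x\<bar>)
     else let r = real_of_ereal p;
              I = (\<integral>\<^sup>+ x. ennreal (\<bar>f x\<bar> powr r) \<partial>lebesgue)
          in if I = \<infinity> then \<infinity> else ereal (enn2real I powr (1 / r)))"

definition Lp :: "ereal \<Rightarrow> (real \<Rightarrow> real) set" where
  "Lp p = {f. f \<in> borel_measurable lebesgue \<and> Lp_norm p f < \<infinity>}"

text \<open>
  For \<open>f \<in> Lp 2\<close> the integrand is integrable for every \<open>t\<close> (Cauchy--Schwarz), so
  the default value \<open>0\<close> of the Bochner integral plays no role there.
\<close>

definition autoconv :: "(real \<Rightarrow> real) \<Rightarrow> real \<Rightarrow> real" where
  "autoconv f t = (LINT x|lebesgue. f (t - x) * f x)"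

definition autoconv_bound :: "real \<Rightarrow> bool" where
  "autoconv_bound c \<longleftrightarrow>
    (\<forall>f \<in> Lp 1 \<inter> Lp 2.
      (Lp_norm 2 (autoconv f))\<^sup>2
        \<le> ereal c * Lp_norm 1 (autoconv f) * Lp_norm \<infinity> (autoconv f))"

end

theory Submission
  imports Defs "HOL-Real_Asymp.Real_Asymp" "HOL-Computational_Algebra.Formal_Power_Series"
begin

text \<open>
  The bound with \<open>c = 1\<close> is Hoelder's inequality applied to \<open>f * f\<close>. For sharpness, \<open>f * f\<close> should
  be close to the indicator function of a long interval. Let \<open>A\<close> be the power series square root
  of \<open>1 + X + \<dots> + X^(N-1) = (1 - X^N) / (1 - X)\<close>, whose coefficients grow at most linearly, and for
  \<open>0 < r < 1\<close> let \<open>f\<close> be the step function with value \<open>A\<^sub>k r^k\<close> on \<open>[k, k+1)\<close>. Then \<open>f * f\<close> is the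
  piecewise linear function that vanishes at \<open>0\<close>, takes the value \<open>r^(k-1)\<close> at \<open>k = 1, \<dots>, N\<close>
  and vanishes from \<open>N+1\<close> on. Letting \<open>r\<close> tend to \<open>1\<close> gives \<open>(N-1)/(N+1) \<le> c\<close>.
\<close>

unbundle no vec_syntax and fps_syntax

section \<open>Norms and measurability\<close>

lemma Lp_norm_1: "Lp_norm 1 f = enn2ereal (\<integral>\<^sup>+ x. ennreal \<bar>f x\<bar> \<partial>lborel)"
proof -
  have "real_of_ereal 1 = 1" by simp
  then show ?thesis
    unfolding Lp_norm_def Let_def nn_integral_completion
    by (cases "\<integral>\<^sup>+ x. ennreal \<bar>f x\<bar> \<partial>lborel") (auto simp: top_ereal_def enn2ereal_ennreal)
qed

text \<open>Squaring cancels the exponent 1/2, and an infinite integral stays infinite on both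
  sides. In this form no square root enters the later estimates.\<close>

lemma Lp_norm_2_square: "(Lp_norm 2 f)\<^sup>2 = enn2ereal (\<integral>\<^sup>+ x. ennreal ((f x)\<^sup>2) \<partial>lborel)"
proof -
  have 2: "real_of_ereal 2 = 2" by (metis numeral_eq_ereal real_of_ereal.simps(1))
  have "(2::ereal) \<noteq> \<infinity>" by simp
  moreover have "\<bar>x\<bar> powr 2 = x\<^sup>2" for x :: real
    by (cases "x = 0") (auto simp: powr_numeral)
  moreover have "(y powr (1/2))\<^sup>2 = y" if "y \<ge> 0" for y :: real
    using that by (simp add: powr_half_sqrt)
  ultimately show ?thesis
    unfolding Lp_norm_def Let_def nn_integral_completion 2
    by (cases "\<integral>\<^sup>+ x. ennreal ((f x)\<^sup>2) \<partial>lborel")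
       (auto simp: top_ereal_def enn2ereal_ennreal power2_eq_square)
qed

lemma Lp_norm_infinity_nonneg: "0 \<le> Lp_norm \<infinity> f"
proof -
  have "0 = esssup lebesgue (\<lambda>x::real. 0::ereal)"
    by (rule esssup_const[symmetric]) simp
  also have "\<dots> \<le> esssup lebesgue (\<lambda>x. ereal \<bar>f x\<bar>)"
    by (rule esssup_mono) auto
  finally show ?thesis by (simp add: Lp_norm_def)
qed

text \<open>Almost everywhere one factor of the square is at most the essential supremum, and
  integrating the resulting bound gives the claim. The computation runs in \<open>ennreal\<close>,
  so infinite norms are covered as well.\<close>

lemma Lp_interpolation:
  assumes [measurable]: "f \<in> borel_measurable borel"
  shows "(Lp_norm 2 f)\<^sup>2 \<le> Lp_norm 1 f * Lp_norm \<infinity> f"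
proof -
  define M where "M = Lp_norm \<infinity> f"
  have M: "M \<ge> 0" unfolding M_def by (rule Lp_norm_infinity_nonneg)
  have "AE x in lebesgue. ereal \<bar>f x\<bar> \<le> M"
    unfolding M_def Lp_norm_def by (simp add: esssup_AE)
  moreover have "ennreal ((f x)\<^sup>2) \<le> e2ennreal M * ennreal \<bar>f x\<bar>" if "ereal \<bar>f x\<bar> \<le> M" for x
  proof -
    have "ennreal \<bar>f x\<bar> \<le> e2ennreal M"
      using e2ennreal_mono[OF that] by simp
    then have "ennreal \<bar>f x\<bar> * ennreal \<bar>f x\<bar> \<le> e2ennreal M * ennreal \<bar>f x\<bar>"
      by (rule mult_right_mono) simp
    then show ?thesis by (simp add: ennreal_mult[symmetric] power2_eq_square)
  qed
  ultimately have "AE x in lebesgue. ennreal ((f x)\<^sup>2) \<le> e2ennreal M * ennreal \<bar>f x\<bar>"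
    by (auto elim: eventually_mono)
  then have "(\<integral>\<^sup>+ x. ennreal ((f x)\<^sup>2) \<partial>lebesgue) \<le> (\<integral>\<^sup>+ x. e2ennreal M * ennreal \<bar>f x\<bar> \<partial>lebesgue)"
    by (rule nn_integral_mono_AE)
  then have "(\<integral>\<^sup>+ x. ennreal ((f x)\<^sup>2) \<partial>lborel) \<le> e2ennreal M * (\<integral>\<^sup>+ x. ennreal \<bar>f x\<bar> \<partial>lborel)"
    by (simp add: nn_integral_completion nn_integral_cmult)
  then show ?thesis
    unfolding Lp_norm_2_square
    using M by (simp add: Lp_norm_1 M_def[symmetric] less_eq_ennreal.rep_eq
        times_ennreal.rep_eq enn2ereal_e2ennreal mult.commute)
qed

text \<open>Replacing \<open>f\<close> by an almost everywhere equal Borel function \<open>g\<close>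
  leaves every value of the autoconvolution unchanged. For \<open>g\<close> the integrand is jointly
  Borel in \<open>t\<close> and \<open>x\<close>, so the integral is Borel in the parameter
  \<open>t\<close>.\<close>

lemma borel_measurable_autoconv:
  assumes "f \<in> borel_measurable lebesgue"
  shows "autoconv f \<in> borel_measurable borel"
proof -
  obtain g where g[measurable]: "g \<in> borel_measurable borel" and fg: "AE x in lborel. f x = g x"
    using completion_ex_borel_measurable_real[OF assms] by auto
  have "autoconv f t = (LINT x|lborel. g (t - x) * g x)" for t
  proof -
    have fg': "AE x in lborel. f (t - x) = g (t - x)"
    proof -
      obtain N where N: "{x. f x \<noteq> g x} \<subseteq> N" "N \<in> null_sets lborel"
        using fg unfolding eventually_ae_filter by auto
      then have [measurable]: "N \<in> sets borel" by auto
      \<comment> \<open>The reflection \<open>x\<close> to \<open>t - x\<close> preserves Lebesgue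
        measure, so it pulls the exceptional null set \<open>N\<close> back to a null set.\<close>
      have lborel_eq: "lborel = density (distr lborel borel (\<lambda>x. t + (-1) * x)) (\<lambda>_. ennreal \<bar>-1\<bar>)"
        by (rule lborel_real_affine) simp
      have "AE x in lborel. x \<notin> N" using N(2) by (rule AE_not_in)
      then have "AE x in density (distr lborel borel (\<lambda>x. t + (-1) * x)) (\<lambda>_. ennreal \<bar>-1\<bar>). x \<notin> N"
        unfolding lborel_eq[symmetric] .
      then have "AE x in lborel. t + (-1) * x \<notin> N"
        by (simp add: AE_density AE_distr_iff)
      then show ?thesis using N(1) by (auto elim!: eventually_mono)
    qed
    have "AE x in lebesgue. f (t - x) * f x = g (t - x) * g x"
      using AE_completion[OF fg] AE_completion[OF fg'] by eventually_elim simp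
    moreover have gm: "(\<lambda>x. g (t - x) * g x) \<in> borel_measurable lborel" by measurable
    moreover have "(\<lambda>x. f (t - x) * f x) \<in> borel_measurable lebesgue"
    proof -
      have "(\<lambda>x. t + (-1) * x) \<in> lebesgue \<rightarrow>\<^sub>M lebesgue"
        using lebesgue_affine_measurable[of "\<lambda>_. -1::real" t] by simp
      then have "(\<lambda>x. f (t + (-1) * x)) \<in> borel_measurable lebesgue"
        using assms by (rule measurable_compose)
      then show ?thesis using assms by simp
    qed
    ultimately have "autoconv f t = (LINT x|lebesgue. g (t - x) * g x)"
      unfolding autoconv_def by (intro integral_cong_AE) (auto intro: measurable_completion)
    then show ?thesis using integral_completion[OF gm] by simp
  qed
  then have "autoconv f = (\<lambda>t. LINT x|lborel. g (t - x) * g x)" by auto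
  then show ?thesis by simp
qed

section \<open>Step functions\<close>

text \<open>The codomain is general because \<open>step\<close> serves both for the real function
  \<open>f\<close> and for the \<open>ennreal\<close> functions against which integrands are
  compared.\<close>

definition step :: "(nat \<Rightarrow> 'a::zero) \<Rightarrow> real \<Rightarrow> 'a" where
  "step a x = (if x < 0 then 0 else a (nat \<lfloor>x\<rfloor>))"

lemma borel_measurable_step [measurable]:
  fixes a :: "nat \<Rightarrow> 'a::{zero, topological_space}"
  shows "step a \<in> borel_measurable borel"
  unfolding step_def[abs_def] by measurable

lemma nat_floor_eq_iff:
  fixes x :: real
  assumes "x \<ge> 0"
  shows "nat \<lfloor>x\<rfloor> = k \<longleftrightarrow> real k \<le> x \<and> x < real k + 1"
  using assms by linarith

text \<open>A step function is a countable sum of multiples of indicators of unit intervals, which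
  can be integrated term by term.\<close>

lemma nn_integral_step:
  fixes g :: "nat \<Rightarrow> ennreal"
  shows "(\<integral>\<^sup>+ x. step g x \<partial>lborel) = (\<Sum>k. g k)"
proof -
  have "step g x = (\<Sum>k. g k * indicator {real k..<real k + 1} x)" for x
  proof (cases "x < 0")
    case True
    then have "g k * indicator {real k..<real k + 1} x = 0" for k by (auto simp: indicator_def)
    then show ?thesis using True by (simp add: step_def)
  next
    case False
    then have "indicator {real k..<real k + 1} x = (if k = nat \<lfloor>x\<rfloor> then 1 else 0 :: ennreal)" for k
      using nat_floor_eq_iff[of x k] by (auto simp: indicator_def)
    then have "(\<Sum>k. g k * indicator {real k..<real k + 1} x)
        = (\<Sum>k\<in>{nat \<lfloor>x\<rfloor>}. g k * indicator {real k..<real k + 1} x)"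
      by (intro suminf_finite) auto
    also have "\<dots> = g (nat \<lfloor>x\<rfloor>)"
      using nat_floor_eq_iff[of x "nat \<lfloor>x\<rfloor>"] False by (auto simp: indicator_def)
    finally show ?thesis using False by (simp add: step_def)
  qed
  then have "(\<integral>\<^sup>+ x. step g x \<partial>lborel) = (\<Sum>k. \<integral>\<^sup>+ x. g k * indicator {real k..<real k + 1} x \<partial>lborel)"
    by (simp add: nn_integral_suminf)
  then show ?thesis by (simp add: nn_integral_cmult_indicator)
qed

lemma step_in_Lp:
  fixes a :: "nat \<Rightarrow> real"
  assumes a: "summable (\<lambda>k. \<bar>a k\<bar>)"
  shows "step a \<in> Lp 1 \<inter> Lp 2"
proof -
  have meas: "step a \<in> borel_measurable lebesgue"
    by (intro measurable_completion) (simp add: borel_measurable_step)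
  have "ennreal \<bar>step a x\<bar> = step (\<lambda>k. ennreal \<bar>a k\<bar>) x"
    and "ennreal ((step a x)\<^sup>2) = step (\<lambda>k. ennreal ((a k)\<^sup>2)) x" for x
    by (auto simp: step_def)
  then have 1: "Lp_norm 1 (step a) = enn2ereal (\<Sum>k. ennreal \<bar>a k\<bar>)"
    and 2: "(Lp_norm 2 (step a))\<^sup>2 = enn2ereal (\<Sum>k. ennreal ((a k)\<^sup>2))"
    by (simp_all only: Lp_norm_1 Lp_norm_2_square nn_integral_step)
  \<comment> \<open>A summable sequence is bounded, say by \<open>B\<close>, so its squares are
    dominated by \<open>B\<close> times its absolute values.\<close>
  have "Bseq a"
    using summable_LIMSEQ_zero[OF summable_rabs_cancel[OF a]] convergent_imp_Bseq convergentI by blast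
  then obtain B where B: "\<And>k. \<bar>a k\<bar> \<le> B" by (auto simp: Bseq_def)
  have "(a k)\<^sup>2 \<le> B * \<bar>a k\<bar>" for k
    using mult_right_mono[OF B[of k], of "\<bar>a k\<bar>"] by (simp add: power2_eq_square)
  then have s2: "summable (\<lambda>k. (a k)\<^sup>2)"
    by (intro summable_comparison_test'[OF summable_mult[OF a, of B]]) simp
  have "Lp_norm 1 (step a) < \<infinity>"
    unfolding 1 using a by (simp add: suminf_ennreal2 enn2ereal_ennreal suminf_nonneg)
  moreover have "(Lp_norm 2 (step a))\<^sup>2 < \<infinity>"
    unfolding 2 using s2 by (simp add: suminf_ennreal2 enn2ereal_ennreal suminf_nonneg)
  then have "Lp_norm 2 (step a) < \<infinity>"
    by (cases "Lp_norm 2 (step a)") (auto simp: power2_eq_square)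
  ultimately show ?thesis using meas by (simp add: Lp_def)
qed

lemma autoconv_step_neg:
  assumes "t < 0"
  shows "autoconv (step a) t = 0"
proof -
  have "(\<lambda>x. step a (t - x) * step a x) = (\<lambda>x. 0)"
    using assms by (auto simp: step_def fun_eq_iff)
  then show ?thesis unfolding autoconv_def by simp
qed

text \<open>For \<open>x\<close> in the cell starting at \<open>k\<close>, the point
  \<open>n + u - x\<close> lies in cell \<open>n - k\<close> on a piece of length \<open>u\<close>
  and in cell \<open>n - 1 - k\<close> on the remaining piece of length \<open>1 - u\<close>. Hence
  the autoconvolution interpolates linearly between consecutive discrete convolutions.\<close>

lemma autoconv_step:
  fixes a :: "nat \<Rightarrow> real" and u :: real
  assumes u: "0 \<le> u" "u < 1"
  shows "autoconv (step a) (real n + u)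
    = u * (\<Sum>k\<le>n. a k * a (n - k)) + (1 - u) * (\<Sum>k<n. a k * a (n - 1 - k))"
proof -
  let ?t = "real n + u"
  \<comment> \<open>The division point \<open>x = k + u\<close> belongs to the first sum, since
    there \<open>?t - x\<close> is exactly \<open>n - k\<close>. The second sum stops before
    \<open>n\<close> because \<open>?t - x\<close> is negative beyond \<open>n + u\<close>.\<close>
  have eq: "step a (?t - x) * step a x =
      (\<Sum>k\<le>n. (a k * a (n - k)) * indicator {real k..real k + u} x)
      + (\<Sum>k<n. (a k * a (n - 1 - k)) * indicator {real k + u<..<real k + 1} x)"
    (is "_ = ?S x + ?T x") for x
  proof (cases "x < 0")
    case True
    then show ?thesis using u by (auto simp: step_def indicator_def intro!: sum.neutral)
  next
    case False
    define m where "m = nat \<lfloor>x\<rfloor>"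
    have m: "real m \<le> x" "x < real m + 1"
      using nat_floor_eq_iff[of x m] False by (auto simp: m_def)
    have un: "k = m" if "real k \<le> x" "x < real k + 1" for k
      using nat_floor_eq_iff[of x k] False that by (auto simp: m_def)
    have S: "?S x = (\<Sum>k\<le>n. if k = m then (if x \<le> real m + u then a m * a (n - m) else 0) else 0)"
      using un m u by (intro sum.cong) (auto simp: indicator_def)
    have T: "?T x = (\<Sum>k<n. if k = m then (if x \<le> real m + u then 0 else a m * a (n - 1 - m)) else 0)"
      using un m u by (intro sum.cong) (auto simp: indicator_def)
    have S': "?S x = (if m \<le> n \<and> x \<le> real m + u then a m * a (n - m) else 0)"
      unfolding S by (subst sum.delta) auto
    have T': "?T x = (if m < n \<and> \<not> x \<le> real m + u then a m * a (n - 1 - m) else 0)"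
      unfolding T by (subst sum.delta) auto
    have L: "step a (?t - x) * step a x = (if ?t < x then 0 else a (nat \<lfloor>?t - x\<rfloor>) * a m)"
      using False by (simp add: step_def m_def)
    show ?thesis
    proof (cases "?t < x")
      case True
      then have "\<not> (m \<le> n \<and> x \<le> real m + u)" "\<not> m < n" using m u by auto
      then show ?thesis unfolding L S' T' using True by auto
    next
      case tx: False
      show ?thesis
      proof (cases "x \<le> real m + u")
        case True
        have mn: "m \<le> n" using m u tx by linarith
        then have "nat \<lfloor>?t - x\<rfloor> = n - m"
          using tx True m u by (subst nat_floor_eq_iff) (auto simp: of_nat_diff)
        then show ?thesis unfolding L S' T' using tx True mn by simp
      next
        case F: False
        then have mn: "m < n" using m u tx by linarith
        then have "nat \<lfloor>?t - x\<rfloor> = n - 1 - m"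
          using tx F m u by (subst nat_floor_eq_iff) (auto simp: of_nat_diff)
        then show ?thesis unfolding L S' T' using tx F mn by simp
      qed
    qed
  qed
  have meas: "(\<lambda>x. step a (?t - x) * step a x) \<in> borel_measurable lborel"
    by measurable
  have "autoconv (step a) ?t = (LINT x|lborel. step a (?t - x) * step a x)"
    unfolding autoconv_def by (rule integral_completion[OF meas])
  also have "\<dots> = (LINT x|lborel. ?S x + ?T x)" by (simp only: eq)
  also have "\<dots> = (LINT x|lborel. ?S x) + (LINT x|lborel. ?T x)"
    using u by (intro Bochner_Integration.integral_add Bochner_Integration.integrable_sum
        integrable_mult_right integrable_real_indicator) auto
  also have "(LINT x|lborel. ?S x) = (\<Sum>k\<le>n. (a k * a (n - k)) * u)"
    using u by (subst Bochner_Integration.integral_sum)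
      (auto intro!: integrable_mult_right integrable_real_indicator)
  also have "(LINT x|lborel. ?T x) = (\<Sum>k<n. (a k * a (n - 1 - k)) * (1 - u))"
    using u by (subst Bochner_Integration.integral_sum)
      (auto intro!: integrable_mult_right integrable_real_indicator)
  finally show ?thesis by (simp add: sum_distrib_left mult.commute)
qed

section \<open>A power series square root\<close>

text \<open>Consecutive coefficients have ratio \<open>(c - k) / (k + 1)\<close>, whose absolute
  value is at most 1.\<close>

lemma abs_gbinomial_le_1:
  fixes c :: real
  assumes "\<bar>c\<bar> \<le> 1"
  shows "\<bar>c gchoose k\<bar> \<le> 1"
proof (induction k)
  case (Suc k)
  have "(c gchoose Suc k) = (c gchoose k) * ((c - real k) / real (Suc k))"
    using gbinomial_mult_1[of c k] by (simp add: field_simps)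
  moreover have "\<bar>(c - real k) / real (Suc k)\<bar> \<le> 1"
    using assms by (auto simp: field_simps abs_if split: if_splits)
  ultimately show ?case
    using Suc mult_mono[of "\<bar>c gchoose k\<bar>" 1 "\<bar>(c - real k) / real (Suc k)\<bar>" 1]
    by (simp add: abs_mult)
qed simp

text \<open>The series is the power \<open>c\<close> of \<open>1 - X^N\<close>: up to sign, its
  coefficients are binomial coefficients spread over the multiples of \<open>N\<close>.\<close>

lemma abs_nth_binomial_compose_le_1:
  fixes c :: real
  assumes c: "\<bar>c\<bar> \<le> 1" and N: "N > 0"
  shows "\<bar>(fps_binomial c oo - (fps_X ^ N)) $ n\<bar> \<le> 1"
proof -
  have pow: "(- (fps_X ^ N) :: real fps) ^ i = fps_const ((-1) ^ i) * fps_X ^ (N * i)" for i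
  proof -
    have "(- (fps_X ^ N) :: real fps) ^ i = (-1) ^ i * fps_X ^ (N * i)"
      by (subst power_minus) (simp add: power_mult)
    also have "(-1 :: real fps) ^ i = fps_const ((-1) ^ i)"
      by (metis fps_const_1_eq_1 fps_const_neg fps_const_power)
    finally show ?thesis .
  qed
  have "\<bar>(fps_binomial c oo - (fps_X ^ N)) $ n\<bar>
      \<le> (\<Sum>i=0..n. \<bar>(c gchoose i) * ((- (fps_X ^ N)) ^ i $ n)\<bar>)"
    unfolding fps_compose_nth by (simp add: sum_abs)
  \<comment> \<open>The \<open>i\<close>-th power contributes only in degree \<open>N * i\<close>,
    so at most the index \<open>n div N\<close> survives.\<close>
  also have "\<dots> \<le> (\<Sum>i=0..n. if i = n div N then 1 else 0)"
    using abs_gbinomial_le_1[OF c] N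
    by (intro sum_mono) (auto simp: pow fps_X_power_nth abs_mult power_abs)
  also have "\<dots> \<le> 1" by simp
  finally show ?thesis .
qed

text \<open>The root is the product of \<open>1 - X^N\<close> to the power 1/2 and
  \<open>1 - X\<close> to the power -1/2. Both factors have coefficients bounded by 1, and the
  Cauchy product in degree \<open>n\<close> has \<open>n + 1\<close> terms.\<close>

lemma sqrt_geometric_fps:
  fixes N :: nat
  assumes N: "N > 0"
  shows "\<exists>A :: real fps. (\<forall>n. (A * A) $ n = (if n < N then 1 else 0)) \<and> (\<forall>n. \<bar>A $ n\<bar> \<le> real n + 1)"
proof -
  define P :: "real \<Rightarrow> real fps" where "P c = fps_binomial c oo - (fps_X ^ N)" for c
  \<comment> \<open>The exponent 1 is kept explicit so that the coefficient bound applies to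
    \<open>Q\<close> as the case \<open>N = 1\<close>.\<close>
  define Q :: "real \<Rightarrow> real fps" where "Q c = fps_binomial c oo - (fps_X ^ 1)" for c
  define A where "A = P (1/2) * Q (-1/2)"
  have PP: "P (1/2) * P (1/2) = 1 - fps_X ^ N"
  proof -
    have "P (1/2) * P (1/2) = fps_binomial (1/2 + 1/2) oo - (fps_X ^ N)"
      unfolding P_def fps_binomial_add_mult using N by (simp add: fps_compose_mult_distrib)
    also have "\<dots> = 1 - fps_X ^ N"
      using N by (simp add: fps_binomial_1 fps_compose_add_distrib)
    finally show ?thesis .
  qed
  have QQ: "Q (-1/2) * Q (-1/2) * (1 - fps_X) = 1"
  proof -
    have "1 - fps_X = Q 1"
      unfolding Q_def by (simp add: fps_binomial_1 fps_compose_add_distrib)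
    then have "Q (-1/2) * Q (-1/2) * (1 - fps_X)
        = fps_binomial (-1/2 + -1/2 + 1) oo - (fps_X ^ 1)"
      unfolding fps_binomial_add_mult by (simp add: Q_def fps_compose_mult_distrib)
    then show ?thesis by simp
  qed
  define G :: "real fps" where "G = Abs_fps (\<lambda>n. if n < N then 1 else 0)"
  have G: "G * (1 - fps_X) = 1 - fps_X ^ N"
  proof (rule fps_ext)
    fix n
    show "(G * (1 - fps_X)) $ n = (1 - fps_X ^ N) $ n"
      using N by (cases n) (auto simp: G_def right_diff_distrib fps_X_power_nth)
  qed
  have "A * A * (1 - fps_X) = (P (1/2) * P (1/2)) * (Q (-1/2) * Q (-1/2) * (1 - fps_X))"
    by (simp add: A_def mult_ac)
  also have "\<dots> = G * (1 - fps_X)" by (simp only: PP QQ G mult_1_right)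
  finally have "A * A * (1 - fps_X) = G * (1 - fps_X)" .
  \<comment> \<open>Real power series form an integral domain, so the nonzero factor
    \<open>1 - X\<close> cancels.\<close>
  moreover have "(1 - fps_X :: real fps) \<noteq> 0" using QQ by auto
  ultimately have AA: "A * A = G" by simp
  have "\<bar>A $ n\<bar> \<le> real n + 1" for n
  proof -
    have "\<bar>A $ n\<bar> \<le> (\<Sum>i=0..n. \<bar>P (1/2) $ i * Q (-1/2) $ (n - i)\<bar>)"
      unfolding A_def fps_mult_nth by (rule sum_abs)
    also have "\<dots> \<le> (\<Sum>i=0..n. 1)"
    proof (rule sum_mono)
      fix i
      have "\<bar>P (1/2) $ i\<bar> \<le> 1" "\<bar>Q (-1/2) $ (n - i)\<bar> \<le> 1"
        unfolding P_def Q_def using N by (intro abs_nth_binomial_compose_le_1; simp)+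
      then show "\<bar>P (1/2) $ i * Q (-1/2) $ (n - i)\<bar> \<le> 1"
        by (simp add: abs_mult mult_le_one)
    qed
    finally show ?thesis by simp
  qed
  then show ?thesis using AA by (intro exI[of _ A]) (simp add: G_def)
qed

section \<open>Sharpness\<close>

text \<open>The test function is evaluated through three estimates: the squared 2-norm is at least
  \<open>(N - 1) * r ^ (2 * N)\<close>, the 1-norm at most \<open>N + 1\<close>, and the sup norm at
  most 1.\<close>

lemma autoconv_bound_ge:
  assumes c: "autoconv_bound c" and N: "N \<ge> 2" and r: "0 < r" "r < 1"
  shows "(real N - 1) * r ^ (2 * N) \<le> c * (real N + 1)"
proof -
  obtain A :: "real fps"
    where AA: "\<And>n. (A * A) $ n = (if n < N then 1 else 0)" and A: "\<And>n. \<bar>A $ n\<bar> \<le> real n + 1"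
    using sqrt_geometric_fps[of N] N by (meson less_le_trans zero_less_numeral)
  \<comment> \<open>The damping by \<open>r ^ k\<close> makes the at most linearly growing
    coefficients summable and merely multiplies the \<open>n\<close>-th convolution by
    \<open>r ^ n\<close>.\<close>
  define a where "a k = A $ k * r ^ k" for k
  define b where "b n = (if n < N then r ^ n else 0)" for n
  have ab: "(\<Sum>k\<le>n. a k * a (n - k)) = b n" for n
  proof -
    have "(\<Sum>k\<le>n. a k * a (n - k)) = (\<Sum>k\<le>n. A $ k * A $ (n - k) * r ^ n)"
      by (intro sum.cong) (auto simp: a_def power_add[symmetric])
    also have "\<dots> = (A * A) $ n * r ^ n"
      by (simp add: fps_mult_nth sum_distrib_right atLeast0AtMost)
    finally show ?thesis by (simp add: AA b_def)
  qed
  have "summable (\<lambda>k. (real k + 1) * r ^ k)"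
    using geometric_deriv_sums[of r] r by (auto simp: sums_iff add.commute)
  then have "summable (\<lambda>k. \<bar>a k\<bar>)"
    using A r by (elim summable_comparison_test') (simp add: a_def abs_mult mult_right_mono)
  then have Lp: "step a \<in> Lp 1 \<inter> Lp 2" by (rule step_in_Lp)

  define F where "F = autoconv (step a)"
  have [measurable]: "F \<in> borel_measurable borel"
    unfolding F_def by (rule borel_measurable_autoconv) (use Lp in \<open>simp add: Lp_def\<close>)
  have b01: "0 \<le> b n" "b n \<le> 1" for n
    using r by (auto simp: b_def power_le_one)
  have bN: "r ^ N \<le> b n" if "n < N" for n
    using that r by (simp add: b_def power_decreasing)
  have F0: "F t = 0" if "t < 0" for t using that by (simp add: F_def autoconv_step_neg)
  \<comment> \<open>The case distinction at \<open>n = 0\<close> reflects the empty second sum;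
    truncated subtraction would give \<open>b 0\<close> there instead of 0.\<close>
  have F: "\<exists>u. 0 \<le> u \<and> u \<le> 1 \<and> F t = u * b n + (1 - u) * (if n = 0 then 0 else b (n - 1))"
    if "0 \<le> t" "n = nat \<lfloor>t\<rfloor>" for t n
  proof (intro exI conjI)
    have t: "t = real n + frac t" using that by (simp add: frac_def)
    show "0 \<le> frac t" "frac t \<le> 1" by (simp_all add: frac_lt_1 less_imp_le)
    have "F (real n + frac t)
      = frac t * (\<Sum>k\<le>n. a k * a (n - k)) + (1 - frac t) * (\<Sum>k<n. a k * a (n - 1 - k))"
      unfolding F_def by (rule autoconv_step) (simp_all add: frac_lt_1)
    moreover have "(\<Sum>k<n. a k * a (n - 1 - k)) = (if n = 0 then 0 else b (n - 1))"
      using ab[of "n - 1"] by (cases n) (auto simp: lessThan_Suc_atMost)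
    ultimately show "F t = frac t * b n + (1 - frac t) * (if n = 0 then 0 else b (n - 1))"
      using t ab by simp
  qed
  have conv: "l \<le> u * x + (1 - u) * y \<and> u * x + (1 - u) * y \<le> h"
    if "0 \<le> u" "u \<le> 1" "l \<le> x" "l \<le> y" "x \<le> h" "y \<le> h" for l h u x y :: real
    using convex_bound_le[of x h y u "1 - u"] convex_bound_le[of "-x" "-l" "-y" u "1 - u"] that by auto
  have F01: "0 \<le> F t" "F t \<le> 1" for t
  proof -
    have "0 \<le> F t \<and> F t \<le> 1"
    proof (cases "t < 0")
      case False
      then obtain u where "0 \<le> u" "u \<le> 1"
        "F t = u * b (nat \<lfloor>t\<rfloor>) + (1 - u) * (if nat \<lfloor>t\<rfloor> = 0 then 0 else b (nat \<lfloor>t\<rfloor> - 1))"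
        using F[of t] by force
      then show ?thesis using conv[of u 0] b01 by simp
    qed (simp add: F0)
    then show "0 \<le> F t" "F t \<le> 1" by auto
  qed

  \<comment> \<open>The support needs the \<open>N + 1\<close> cells with indices up to
    \<open>N\<close>: cell \<open>N\<close> carries the descent from \<open>b (N - 1)\<close> to 0,
    and past it both interpolated values vanish.\<close>
  have upper: "ennreal \<bar>F t\<bar> \<le> step (\<lambda>k. if k \<in> {..N} then 1 else 0) t" for t
  proof (cases "t < 0")
    case False
    show ?thesis
    proof (cases "nat \<lfloor>t\<rfloor> \<le> N")
      case True
      then show ?thesis using False F01[of t] by (simp add: step_def)
    next
      case gt: False
      then have "F t = 0" using F[of t "nat \<lfloor>t\<rfloor>"] False by (auto simp: b_def)
      then show ?thesis by simp
    qed
  qed (simp add: F0)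
  \<comment> \<open>Cells 0 and \<open>N\<close> are left out because \<open>F\<close> interpolates
    with the value 0 there. On the \<open>N - 1\<close> cells between, both interpolated values are
    at least \<open>r ^ N\<close>.\<close>
  have lower: "step (\<lambda>k. if k \<in> {1..<N} then ennreal (r ^ (2 * N)) else 0) t \<le> ennreal ((F t)\<^sup>2)" for t
  proof (cases "0 \<le> t \<and> nat \<lfloor>t\<rfloor> \<in> {1..<N}")
    case True
    then have "nat \<lfloor>t\<rfloor> \<noteq> 0" by (metis atLeastLessThan_iff not_one_le_zero)
    with True obtain u where "0 \<le> u" "u \<le> 1" "F t = u * b (nat \<lfloor>t\<rfloor>) + (1 - u) * b (nat \<lfloor>t\<rfloor> - 1)"
      using F[of t "nat \<lfloor>t\<rfloor>"] by metis
    moreover have "r ^ N \<le> b (nat \<lfloor>t\<rfloor>)" "r ^ N \<le> b (nat \<lfloor>t\<rfloor> - 1)"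
      using True by (auto intro!: bN)
    ultimately have "r ^ N \<le> F t" using conv[of u "r ^ N" _ _ 1] b01 by simp
    then have "(r ^ N)\<^sup>2 \<le> (F t)\<^sup>2" using r by (intro power_mono) auto
    then show ?thesis using True by (simp add: step_def power_mult[symmetric] mult.commute)
  qed (auto simp: step_def)

  have "(\<integral>\<^sup>+ t. ennreal \<bar>F t\<bar> \<partial>lborel) \<le> (\<Sum>k. if k \<in> {..N} then 1 else 0)"
    unfolding nn_integral_step[symmetric] by (intro nn_integral_mono upper)
  also have "\<dots> = ennreal (real N + 1)"
    by (subst suminf_finite[of "{..N}"]) (auto simp: ennreal_of_nat_eq_real_of_nat add.commute)
  finally have I1: "Lp_norm 1 F \<le> ereal (real N + 1)"
    unfolding Lp_norm_1 less_eq_ennreal.rep_eq by (simp add: enn2ereal_ennreal del: ennreal_plus)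
  have I1_nonneg: "0 \<le> Lp_norm 1 F" by (simp add: Lp_norm_1)

  have "ennreal ((real N - 1) * r ^ (2 * N))
      = (\<Sum>k. if k \<in> {1..<N} then ennreal (r ^ (2 * N)) else 0)"
    using N r by (subst suminf_finite[of "{1..<N}"])
      (auto simp: ennreal_of_nat_eq_real_of_nat ennreal_mult[symmetric] of_nat_diff)
  also have "\<dots> \<le> (\<integral>\<^sup>+ t. ennreal ((F t)\<^sup>2) \<partial>lborel)"
    unfolding nn_integral_step[symmetric] by (intro nn_integral_mono lower)
  finally have I2: "ereal ((real N - 1) * r ^ (2 * N)) \<le> (Lp_norm 2 F)\<^sup>2"
    unfolding Lp_norm_2_square less_eq_ennreal.rep_eq using N r by (simp add: enn2ereal_ennreal)

  have M: "Lp_norm \<infinity> F \<le> 1"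
  proof -
    have "Lp_norm \<infinity> F = esssup lebesgue (\<lambda>x. ereal \<bar>F x\<bar>)" by (simp add: Lp_norm_def)
    also have "\<dots> \<le> 1"
      by (rule esssup_I) (use F01 in \<open>auto intro: measurable_completion\<close>)
    finally show ?thesis .
  qed
  obtain i where i: "Lp_norm 1 F = ereal i" "0 \<le> i" "i \<le> real N + 1"
    using I1 I1_nonneg by (cases "Lp_norm 1 F") auto
  obtain m where m: "Lp_norm \<infinity> F = ereal m" "0 \<le> m" "m \<le> 1"
    using M Lp_norm_infinity_nonneg[of F] by (cases "Lp_norm \<infinity> F") auto
  have "(Lp_norm 2 F)\<^sup>2 \<le> ereal c * Lp_norm 1 F * Lp_norm \<infinity> F"
    using c Lp unfolding autoconv_bound_def F_def by blast
  with I2 have "ereal ((real N - 1) * r ^ (2 * N)) \<le> ereal c * Lp_norm 1 F * Lp_norm \<infinity> F"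
    by (rule order_trans)
  then have le: "(real N - 1) * r ^ (2 * N) \<le> c * (i * m)" using i m by (simp add: mult.assoc)
  \<comment> \<open>Positivity of the left side forces \<open>c\<close> to be nonnegative, which
    permits replacing \<open>i * m\<close> by its upper bound \<open>N + 1\<close>.\<close>
  have "0 < (real N - 1) * r ^ (2 * N)" using N r by simp
  with le have "0 < c * (i * m)" by simp
  then have "0 \<le> c" using i m by (auto simp: zero_less_mult_iff mult_less_0_iff)
  have "i * m \<le> (real N + 1) * 1" using i m by (intro mult_mono) auto
  then have "c * (i * m) \<le> c * (real N + 1)" using \<open>0 \<le> c\<close> by (intro mult_left_mono) auto
  with le show ?thesis by simp
qed

theorem theorem5p1:
  shows "autoconv_bound 1 \<and> (\<forall>c. autoconv_bound c \<longrightarrow> 1 \<le> c)"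
proof (intro conjI allI impI)
  show "autoconv_bound 1"
    unfolding autoconv_bound_def
    using Lp_interpolation[OF borel_measurable_autoconv] by (auto simp: Lp_def one_ereal_def[symmetric])
next
  fix c
  assume c: "autoconv_bound c"
  \<comment> \<open>With \<open>N\<close> fixed, \<open>r\<close> tends to 1 from below; the limit
    in \<open>N\<close> is taken afterwards.\<close>
  have bound: "real N - 1 \<le> c * (real N + 1)" if N: "N \<ge> 2" for N
  proof (rule tendsto_upperbound)
    show "((\<lambda>r. (real N - 1) * r ^ (2 * N)) \<longlongrightarrow> real N - 1) (at_left 1)"
      by (auto intro!: tendsto_eq_intros)
    have "eventually (\<lambda>r::real. r \<in> {0<..<1}) (at_left 1)"
      by (rule eventually_at_left_real) simp
    then show "eventually (\<lambda>r. (real N - 1) * r ^ (2 * N) \<le> c * (real N + 1)) (at_left 1)"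
      by eventually_elim (use autoconv_bound_ge[OF c N] in auto)
  qed simp
  show "1 \<le> c"
  proof (rule tendsto_upperbound)
    show "(\<lambda>N. (real N - 1) / (real N + 1)) \<longlonglongrightarrow> 1" by real_asymp
    show "eventually (\<lambda>N. (real N - 1) / (real N + 1) \<le> c) sequentially"
      using eventually_ge_at_top[of 2] by eventually_elim (use bound in \<open>simp add: divide_simps\<close>)
  qed simp
qed

end
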